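(* Let $B\subset\mathbb{Z}$ be a set with $N$ elements and let $\Lambda\subset\mathbb{R}$ be a spectrum of $B$. Assume $0\in B$ and $0\in\Lambda$. Suppose the Hadamard matrix associated to $(B,\Lambda)$ is equivalent to the standard $N\times N$ Hadamard matrix. Then $B$ has the form $B=dB_0$, where $d$ is an integer and $B_0$ is a complete set of residues modulo $N$ with $\gcd(B_0)=1$. In this case, any such spectrum $\Lambda$ has the form $\Lambda=\frac1R fL_0$, where $f$ and $R$ are integers, $L_0$ is a complete set of residues modulo $N$ with greatest common divisor one, and $R=NS$, where $S$ is an integer that divides $df$ and $\frac{df}{S}$ is relatively prime to $N$. The converse also holds: if $0\in B=dB_0$ and $0\in\Lambda=\frac1RfL_0$ with $d,f,R,S$ integers, $R=NS\neq0$, $B_0,L_0$ complete sets of residues modulo $N$ with greatest common divisor one, $S$ dividing $df$ and $\frac{df}{S}$ relatively prime to $N$, then $\Lambda$ is a spectrum of $B$ and the Hadamard matrix associated to $(B,\Lambda)$ is equivalent to the standard $N\times N$ Hadamard matrix.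
   Context: A finite set $B\subset\mathbb{R}$ has spectrum $\Lambda\subset\mathbb{R}$ if $\{e^{2\pi i\lambda x}:\lambda\in\Lambda\}$ is an orthogonal basis of $L^2$ of the counting measure on $B$; then $\#\Lambda=\#B=N$ and the matrix $\frac1{\sqrt N}(e^{2\pi i b\lambda})_{b\in B,\lambda\in\Lambda}$ is called the Hadamard matrix associated to $(B,\Lambda)$ (for some ordering of $B$ and $\Lambda$). An $N\times N$ complex matrix is a Hadamard matrix if it is unitary and all its entries have absolute value $\frac1{\sqrt N}$. Two Hadamard matrices $H,H'$ are equivalent if there exist permutations $\pi,\rho$ of $\{1,\dots,N\}$ and complex numbers $c_1,\dots,c_N,d_1,\dots,d_N$ of absolute value $1$ such that $H'_{ij}=c_id_jH_{\pi(i)\rho(j)}$ for all $i,j$. The standard Hadamard matrix is $\frac1{\sqrt N}(e^{2\pi i\frac{jk}{N}})_{j,k=0}^{N-1}$. A complete set of residues modulo $N$ is a set of $N$ integers that are pairwise incongruent modulo $N$. For a set $A\subset\mathbb{R}$ and $c\in\mathbb{R}$, $cA=\{ca:a\in A\}$. *)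

theory Defs
  imports
    "HOL-Analysis.Analysis"
    "HOL-Combinatorics.Permutations"
    "HOL-Number_Theory.Cong"
    "Jordan_Normal_Form.Schur_Decomposition"
begin

definition exponential :: "real \<Rightarrow> real \<Rightarrow> complex" where
  "exponential t x = exp (2 * of_real pi * \<i> * of_real (t * x))"

definition l2_inner :: "real set \<Rightarrow> (real \<Rightarrow> complex) \<Rightarrow> (real \<Rightarrow> complex) \<Rightarrow> complex" where
  "l2_inner B f g = (LINT x | count_space B. f x * cnj (g x))"

text \<open>
  For finite \<open>B\<close>, the space \<open>L\<^sup>2\<close> of the counting measure on \<open>B\<close> is the space of all functions
  \<open>B \<rightarrow> \<complex>\<close>; its elements are represented by functions on \<open>\<real>\<close> of which only the restriction
  to \<open>B\<close> matters. A basis is an indexed family: distinct indices have to give distinct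
  (indeed orthogonal) members, so that its index set has \<open>card B\<close> elements. Without this,
  \<open>{0, 1}\<close> would be a spectrum of \<open>{0}\<close>.
\<close>

definition orthogonal_basis_on :: "real set \<Rightarrow> 'i set \<Rightarrow> ('i \<Rightarrow> real \<Rightarrow> complex) \<Rightarrow> bool" where
  "orthogonal_basis_on B I e \<longleftrightarrow>
     (\<forall>i\<in>I. l2_inner B (e i) (e i) \<noteq> 0) \<and>
     (\<forall>i\<in>I. \<forall>j\<in>I. i \<noteq> j \<longrightarrow> l2_inner B (e i) (e j) = 0) \<and>
     (\<forall>f. \<exists>J c. finite J \<and> J \<subseteq> I \<and> (\<forall>x\<in>B. f x = (\<Sum>i\<in>J. c i * e i x)))"

definition is_spectrum :: "real set \<Rightarrow> real set \<Rightarrow> bool" where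
  "is_spectrum B \<Lambda> \<longleftrightarrow> finite B \<and> orthogonal_basis_on B \<Lambda> exponential"

definition hadamard_matrix :: "nat \<Rightarrow> complex mat \<Rightarrow> bool" where
  "hadamard_matrix N H \<longleftrightarrow>
     H \<in> carrier_mat N N \<and>
     H * mat_adjoint H = 1\<^sub>m N \<and> mat_adjoint H * H = 1\<^sub>m N \<and>
     (\<forall>i<N. \<forall>j<N. cmod (H $$ (i, j)) = 1 / sqrt (real N))"

text \<open>Matrix indices start at 0, so permutations of \<open>{1..N}\<close> become permutations of \<open>{..<N}\<close>.\<close>

definition hadamard_equivalent :: "nat \<Rightarrow> complex mat \<Rightarrow> complex mat \<Rightarrow> bool" where
  "hadamard_equivalent N H H' \<longleftrightarrow>
     hadamard_matrix N H \<and> hadamard_matrix N H' \<and>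
     (\<exists>\<pi> \<rho> c d. \<pi> permutes {..<N} \<and> \<rho> permutes {..<N} \<and>
        (\<forall>i<N. cmod (c i) = 1) \<and> (\<forall>j<N. cmod (d j) = 1) \<and>
        (\<forall>i<N. \<forall>j<N. H' $$ (i, j) = c i * d j * H $$ (\<pi> i, \<rho> j)))"

definition standard_hadamard_matrix :: "nat \<Rightarrow> complex mat" where
  "standard_hadamard_matrix N = mat N N (\<lambda>(j, k).
     1 / of_real (sqrt (real N)) * exp (2 * of_real pi * \<i> * of_real (real (j * k) / real N)))"

text \<open>The bijections \<open>b\<close> and \<open>l\<close> are the orderings of \<open>B\<close> and \<open>\<Lambda>\<close>.\<close>

definition associated_matrix :: "nat \<Rightarrow> real set \<Rightarrow> real set \<Rightarrow> complex mat \<Rightarrow> bool" where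
  "associated_matrix N B \<Lambda> H \<longleftrightarrow>
     (\<exists>b l. bij_betw b {..<N} B \<and> bij_betw l {..<N} \<Lambda> \<and>
        H = mat N N (\<lambda>(i, j).
          1 / of_real (sqrt (real N)) * exponential (l j) (b i)))"

definition complete_residues :: "nat \<Rightarrow> int set \<Rightarrow> bool" where
  "complete_residues N A \<longleftrightarrow>
     finite A \<and> card A = N \<and> (\<forall>a\<in>A. \<forall>b\<in>A. a \<noteq> b \<longrightarrow> \<not> [a = b] (mod int N))"

text \<open>The parameter \<open>d\<close> is the dilation factor in \<open>B = d B\<^sub>0\<close>.\<close>

definition spectrum_form ::
  "nat \<Rightarrow> int \<Rightarrow> real set \<Rightarrow> int \<Rightarrow> int \<Rightarrow> int \<Rightarrow> int set \<Rightarrow> bool" where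
  "spectrum_form N d \<Lambda> f R S L\<^sub>0 \<longleftrightarrow>
     \<Lambda> = (\<lambda>l. 1 / of_int R * (of_int f * of_int l)) ` L\<^sub>0 \<and>
     complete_residues N L\<^sub>0 \<and> Gcd L\<^sub>0 = 1 \<and>
     R = int N * S \<and> R \<noteq> 0 \<and>
     S dvd d * f \<and> coprime (d * f div S) (int N)"

end

(* Since 0 lies in B and in \<Lambda>, comparing a row and a column of the standard matrix with the row of
   b = 0 and the column of \<lambda> = 0 removes the unimodular factors of the equivalence: up to reordering,
   exp(2 pi i \<lambda> b) is the N-th root of unity of exponent (j - j0)(k - k0). Fixing \<lambda> at k = k0 + 1 shows
   that N \<lambda> b is an integer congruent to j - j0, so b divided by the gcd d of B still determines
   j modulo N; by Bezout N d \<Lambda> consists of integers, and the same argument with b at j = j0 + 1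
   applies to it. The converse is the orthogonality of the characters of the cyclic group. *)

theory Submission
  imports Defs
begin

section \<open>The character t -> exp(2 pi i t) and congruences modulo N\<close>

definition unit_exp :: "real \<Rightarrow> complex" where
  "unit_exp t = cis (2 * pi * t)"

lemma exponential_eq_unit_exp: "exponential t x = unit_exp (t * x)"
  by (simp add: exponential_def unit_exp_def cis_conv_exp algebra_simps)

lemma unit_exp_add: "unit_exp (s + t) = unit_exp s * unit_exp t"
  by (simp add: unit_exp_def cis_mult algebra_simps)

lemma unit_exp_0 [simp]: "unit_exp 0 = 1"
  by (simp add: unit_exp_def)

lemma norm_unit_exp [simp]: "cmod (unit_exp t) = 1"
  by (simp add: unit_exp_def)

lemma unit_exp_nonzero [simp]: "unit_exp t \<noteq> 0"
  by (simp add: unit_exp_def)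

lemma cnj_unit_exp: "cnj (unit_exp t) = unit_exp (- t)"
  by (simp add: unit_exp_def cis_cnj)

lemma unit_exp_eq_1_iff: "unit_exp t = 1 \<longleftrightarrow> t \<in> \<int>"
proof
  assume "unit_exp t = 1"
  then have "cos (2 * pi * t) = 1"
    by (simp add: unit_exp_def complex_eq_iff)
  then obtain n :: int where "2 * pi * t = of_int n * 2 * pi"
    using cos_one_2pi_int by blast
  then have "t = of_int n" by simp
  then show "t \<in> \<int>" by simp
next
  assume "t \<in> \<int>"
  then show "unit_exp t = 1"
    by (auto simp: unit_exp_def elim!: Ints_cases)
qed

lemma unit_exp_eq_iff: "unit_exp s = unit_exp t \<longleftrightarrow> s - t \<in> \<int>"
proof -
  have "unit_exp s = unit_exp (s - t) * unit_exp t"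
    by (simp flip: unit_exp_add)
  then show ?thesis
    using unit_exp_eq_1_iff[of "s - t"] by auto
qed

lemma unit_exp_power: "unit_exp t ^ n = unit_exp (of_nat n * t)"
  by (induction n) (simp_all add: unit_exp_add algebra_simps)

lemma unit_exp_div_eq_iff:
  assumes "N > 0"
  shows "unit_exp (of_int a / of_nat N) = unit_exp (of_int b / of_nat N) \<longleftrightarrow> [a = b] (mod int N)"
proof -
  have "of_int a / of_nat N - of_int b / of_nat N \<in> (\<int> :: real set) \<longleftrightarrow> int N dvd a - b"
  proof
    assume "of_int a / of_nat N - of_int b / of_nat N \<in> (\<int> :: real set)"
    then obtain k where "of_int a / of_nat N - of_int b / of_nat N = (of_int k :: real)"
      by (auto elim: Ints_cases)
    with assms have "of_int (a - b) = (of_int (int N * k) :: real)"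
      by (simp add: field_simps)
    then have "a - b = int N * k" by (simp only: of_int_eq_iff)
    then show "int N dvd a - b" by simp
  next
    assume "int N dvd a - b"
    then obtain k where "a - b = int N * k" ..
    then have "of_int (a - b) = (of_int (int N * k) :: real)" by (simp only:)
    then have "of_int a / of_nat N - of_int b / of_nat N = (of_int k :: real)"
      using assms by (simp add: field_simps)
    then show "of_int a / of_nat N - of_int b / of_nat N \<in> (\<int> :: real set)" by simp
  qed
  then show ?thesis by (simp add: unit_exp_eq_iff cong_iff_dvd_diff)
qed

section \<open>Complete residue systems and their character sums\<close>

lemma complete_residues_bij_betw:
  assumes "complete_residues N A" "N > 0"
  shows "bij_betw (\<lambda>a. nat (a mod int N)) A {..<N}"
proof -
  have inj: "inj_on (\<lambda>a. nat (a mod int N)) A"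
    using assms by (auto simp: complete_residues_def inj_on_def cong_def nat_eq_iff)
  have "(\<lambda>a. nat (a mod int N)) ` A \<subseteq> {..<N}"
    using assms(2) by (auto simp: nat_less_iff)
  moreover have "card ((\<lambda>a. nat (a mod int N)) ` A) = card {..<N}"
    using assms(1) inj by (simp add: card_image complete_residues_def)
  ultimately have "(\<lambda>a. nat (a mod int N)) ` A = {..<N}"
    by (intro card_subset_eq) auto
  with inj show ?thesis by (simp add: bij_betw_def)
qed

text \<open>The summand depends only on the residue of \<open>a\<close>, so this is a geometric sum
  over \<open>k < N\<close> in an N-th root of unity z. Since z ^ N = 1, it vanishes unless z = 1,
  that is, unless N divides \<open>c\<close>.\<close>

lemma sum_unit_exp_complete_residues:
  assumes "complete_residues N A" "N > 0"
  shows "(\<Sum>a\<in>A. unit_exp (of_int (c * a) / of_nat N)) = (if int N dvd c then of_nat N else 0)"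
proof -
  let ?z = "unit_exp (of_int c / of_nat N)"
  have "unit_exp (of_int (c * a) / of_nat N) = ?z ^ nat (a mod int N)" for a
  proof -
    have "[c * a = int (nat (a mod int N)) * c] (mod int N)"
      using assms(2) by (simp add: cong_def mult.commute mod_mult_right_eq)
    then have "unit_exp (of_int (c * a) / of_nat N)
        = unit_exp (of_int (int (nat (a mod int N)) * c) / of_nat N)"
      using assms(2) by (subst unit_exp_div_eq_iff)
    then show ?thesis by (simp add: unit_exp_power)
  qed
  then have "(\<Sum>a\<in>A. unit_exp (of_int (c * a) / of_nat N)) = (\<Sum>a\<in>A. ?z ^ nat (a mod int N))"
    by simp
  also have "\<dots> = (\<Sum>k<N. ?z ^ k)"
    using complete_residues_bij_betw[OF assms]
    by (rule sum.reindex_bij_betw[of "\<lambda>a. nat (a mod int N)" A "{..<N}" "\<lambda>k. ?z ^ k"])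
  also have "\<dots> = (if int N dvd c then of_nat N else 0)"
  proof -
    have iff: "?z = 1 \<longleftrightarrow> int N dvd c"
      using unit_exp_div_eq_iff[OF assms(2), of c 0] by (simp add: cong_0_iff)
    have "?z ^ N = 1"
      using assms(2) by (simp add: unit_exp_power unit_exp_eq_1_iff)
    then show ?thesis
      using iff by (cases "?z = 1") (auto simp: sum_gp_strict)
  qed
  finally show ?thesis .
qed

text \<open>A factor coprime to N cancels from a congruence. In the converse this absorbs the unit
  df / S into the row labels.\<close>

lemma complete_residues_mult:
  assumes "complete_residues N A" "coprime m (int N)" "N > 0"
  shows "complete_residues N ((\<lambda>a. m * a) ` A)" "inj_on (\<lambda>a. m * a) A"
proof -
  have *: "a = b" if "a \<in> A" "b \<in> A" "[m * a = m * b] (mod int N)" for a b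
    using assms that by (auto simp: complete_residues_def cong_mult_lcancel)
  show inj: "inj_on (\<lambda>a. m * a) A"
    by (rule inj_onI) (auto intro: * simp: cong_def)
  show "complete_residues N ((\<lambda>a. m * a) ` A)"
    using assms(1) inj * by (auto simp: complete_residues_def card_image)
qed

lemma sum_unit_exp_index:
  assumes "bij_betw p {..<N} A" "complete_residues N A" "N > 0"
  shows "(\<Sum>k<N. unit_exp (of_int (c * p k) / of_nat N)) = (if int N dvd c then of_nat N else 0)"
  using sum.reindex_bij_betw[OF assms(1), of "\<lambda>a. unit_exp (of_int (c * a) / of_nat N)"]
    sum_unit_exp_complete_residues[OF assms(2,3), of c]
  by simp

section \<open>Hadamard matrices labelled by residue systems\<close>

text \<open>A common shape for the standard matrix (\<open>p = q = int\<close>) and the associated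
  matrices of the converse: an entry depends only on the residues of \<open>p i\<close> and
  \<open>q j\<close> modulo N.\<close>

definition residue_matrix :: "nat \<Rightarrow> (nat \<Rightarrow> int) \<Rightarrow> (nat \<Rightarrow> int) \<Rightarrow> complex mat" where
  "residue_matrix N p q = mat N N (\<lambda>(i, j).
     1 / of_real (sqrt (real N)) * unit_exp (of_int (p i * q j) / of_nat N))"

text \<open>The inner product of two rows is a character sum over the column labels with frequency
  \<open>p i - p j\<close>, which N divides only for \<open>i = j\<close>. For columns the roles of
  \<open>p\<close> and \<open>q\<close> are exchanged.\<close>

lemma hadamard_residue_matrix:
  assumes p: "bij_betw p {..<N} A" "complete_residues N A"
    and q: "bij_betw q {..<N} A'" "complete_residues N A'" and N: "N > 0"
  shows "hadamard_matrix N (residue_matrix N p q)"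
proof -
  let ?s = "complex_of_real (sqrt (real N))"
  let ?H = "residue_matrix N p q"
  have s: "?s * ?s = of_nat N" "?s \<noteq> 0" "cnj ?s = ?s"
    using N by (simp_all flip: of_real_mult)
  have incong: "\<not> int N dvd r i - r j"
    if "bij_betw r {..<N} C" "complete_residues N C" "i < N" "j < N" "i \<noteq> j" for r C i j
  proof -
    have "r i \<in> C" "r j \<in> C" "r i \<noteq> r j"
      using that by (auto simp: bij_betw_def inj_on_def)
    with that(2) show ?thesis
      by (auto simp: complete_residues_def cong_iff_dvd_diff)
  qed
  \<comment> \<open>One term of such an inner product: the two normalisations combine to 1 / N, and
    conjugation turns the product of phases into a difference of exponents.\<close>
  have ent: "1 / ?s * unit_exp (of_int a / of_nat N) * cnj (1 / ?s * unit_exp (of_int b / of_nat N))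
      = unit_exp (of_int (a - b) / of_nat N) / of_nat N" for a b
  proof -
    have "unit_exp (of_int (a - b) / of_nat N) =
        unit_exp (of_int a / of_nat N) * cnj (unit_exp (of_int b / of_nat N))"
      by (simp add: cnj_unit_exp diff_divide_distrib flip: unit_exp_add)
    then show ?thesis using s by (simp add: field_simps)
  qed
  have row: "(\<Sum>k<N. ?H $$ (i, k) * cnj (?H $$ (j, k))) = (if i = j then 1 else 0)"
    if "i < N" "j < N" for i j
  proof -
    have "(\<Sum>k<N. ?H $$ (i, k) * cnj (?H $$ (j, k)))
        = (\<Sum>k<N. unit_exp (of_int ((p i - p j) * q k) / of_nat N) / of_nat N)"
      using that unfolding residue_matrix_def
      by (intro sum.cong refl) (simp only: index_mat lessThan_iff prod.case ent left_diff_distrib)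
    also have "\<dots> = (if i = j then 1 else 0)"
      using sum_unit_exp_index[OF q N, of "p i - p j"] incong[OF p, of i j] that N
      by (auto simp flip: sum_divide_distrib)
    finally show ?thesis .
  qed
  have col: "(\<Sum>k<N. cnj (?H $$ (k, i)) * ?H $$ (k, j)) = (if i = j then 1 else 0)"
    if "i < N" "j < N" for i j
  proof -
    have "(\<Sum>k<N. cnj (?H $$ (k, i)) * ?H $$ (k, j))
        = (\<Sum>k<N. ?H $$ (k, j) * cnj (?H $$ (k, i)))"
      by (simp only: mult.commute)
    also have "\<dots> = (\<Sum>k<N. unit_exp (of_int ((q j - q i) * p k) / of_nat N) / of_nat N)"
      using that unfolding residue_matrix_def
      by (intro sum.cong refl)
        (simp only: index_mat lessThan_iff prod.case ent left_diff_distrib mult.commute[of "p _"])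
    also have "\<dots> = (if i = j then 1 else 0)"
      using sum_unit_exp_index[OF p N, of "q j - q i"] incong[OF q, of j i] that N
      by (auto simp flip: sum_divide_distrib)
    finally show ?thesis .
  qed
  have dim: "?H \<in> carrier_mat N N" by (simp add: residue_matrix_def)
  have adj: "mat_adjoint ?H \<in> carrier_mat N N"
    "\<And>i j. i < N \<Longrightarrow> j < N \<Longrightarrow> mat_adjoint ?H $$ (i, j) = cnj (?H $$ (j, i))"
    using dim by (auto simp: mat_adjoint_def mat_of_rows_def)
  have "?H * mat_adjoint ?H = 1\<^sub>m N"
    using dim adj row
    by (intro eq_matI) (auto simp: scalar_prod_def atLeast0LessThan)
  moreover have "mat_adjoint ?H * ?H = 1\<^sub>m N"
    using dim adj col
    by (intro eq_matI) (auto simp: scalar_prod_def atLeast0LessThan)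
  moreover have "cmod (?H $$ (i, j)) = 1 / sqrt (real N)" if "i < N" "j < N" for i j
    using that N by (simp add: residue_matrix_def norm_mult norm_divide)
  ultimately show ?thesis
    using dim by (simp add: hadamard_matrix_def)
qed

lemma complete_residues_interval: "complete_residues N (int ` {..<N})"
  by (auto simp: complete_residues_def card_image cong_def)

lemma standard_hadamard_matrix_eq: "standard_hadamard_matrix N = residue_matrix N int int"
  by (rule eq_matI)
    (simp_all add: standard_hadamard_matrix_def residue_matrix_def unit_exp_def cis_conv_exp
      algebra_simps)

lemma hadamard_standard: "N > 0 \<Longrightarrow> hadamard_matrix N (standard_hadamard_matrix N)"
  unfolding standard_hadamard_matrix_eq
  using complete_residues_interval
  by (intro hadamard_residue_matrix[of int N "int ` {..<N}" int "int ` {..<N}"])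
     (auto simp: bij_betw_def)

text \<open>Reduction modulo N turns \<open>p\<close> into a permutation of the indices; its inverse
  sorts the labels by residue.\<close>

lemma permutation_of_residues:
  assumes "bij_betw p {..<N} A" "complete_residues N A" "N > 0"
  obtains \<pi> where "\<pi> permutes {..<N}" "\<And>i. i < N \<Longrightarrow> [p (\<pi> i) = int i] (mod int N)"
proof -
  have "bij_betw (\<lambda>i. nat (p i mod int N)) {..<N} {..<N}"
    using bij_betw_trans[OF assms(1) complete_residues_bij_betw[OF assms(2,3)]]
    by (simp add: o_def)
  then have inv: "bij_betw (inv_into {..<N} (\<lambda>i. nat (p i mod int N))) {..<N} {..<N}"
    (is "bij_betw ?g _ _")
    by (rule bij_betw_inv_into)
  \<comment> \<open>\<open>permutes\<close> requires that every index outside \<open>{..<N}\<close>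
    be fixed.\<close>
  define \<pi> where "\<pi> i = (if i < N then ?g i else i)" for i
  have "bij_betw \<pi> {..<N} {..<N}"
    using inv by (rule bij_betw_cong[THEN iffD1, rotated]) (simp add: \<pi>_def)
  then have "\<pi> permutes {..<N}"
    by (rule bij_imp_permutes) (simp add: \<pi>_def)
  moreover have "[p (\<pi> i) = int i] (mod int N)" if "i < N" for i
  proof -
    have "nat (p (?g i) mod int N) = i"
      using \<open>bij_betw (\<lambda>i. nat (p i mod int N)) {..<N} {..<N}\<close> that
      by (intro f_inv_into_f[of i "\<lambda>i. nat (p i mod int N)" "{..<N}"]) (simp add: bij_betw_def)
    then have "p (?g i) mod int N = int i"
      using \<open>N > 0\<close> by (metis int_nat_eq pos_mod_sign of_nat_0_less_iff)
    with that show ?thesis by (simp add: \<pi>_def cong_def)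
  qed
  ultimately show thesis by (rule that)
qed

text \<open>Sorting rows and columns by the residues of their labels already produces the standard
  matrix, so all unimodular factors can be 1.\<close>

lemma residue_matrix_equivalent_standard:
  assumes p: "bij_betw p {..<N} A" "complete_residues N A"
    and q: "bij_betw q {..<N} A'" "complete_residues N A'" and N: "N > 0"
  shows "hadamard_equivalent N (residue_matrix N p q) (standard_hadamard_matrix N)"
proof -
  obtain \<pi> where \<pi>: "\<pi> permutes {..<N}" "\<And>i. i < N \<Longrightarrow> [p (\<pi> i) = int i] (mod int N)"
    using permutation_of_residues[OF p N] by blast
  obtain \<rho> where \<rho>: "\<rho> permutes {..<N}" "\<And>i. i < N \<Longrightarrow> [q (\<rho> i) = int i] (mod int N)"
    using permutation_of_residues[OF q N] by blast
  have "standard_hadamard_matrix N $$ (i, j) = 1 * 1 * residue_matrix N p q $$ (\<pi> i, \<rho> j)"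
    if "i < N" "j < N" for i j
  proof -
    have "\<pi> i < N" "\<rho> j < N"
      using \<pi>(1) \<rho>(1) that by (metis lessThan_iff permutes_in_image)+
    moreover have "unit_exp (of_int (int i * int j) / of_nat N)
        = unit_exp (of_int (p (\<pi> i) * q (\<rho> j)) / of_nat N)"
      using N \<pi>(2) \<rho>(2) that by (subst unit_exp_div_eq_iff) (auto intro: cong_mult cong_sym)
    ultimately show ?thesis
      using that unfolding standard_hadamard_matrix_eq by (simp add: residue_matrix_def)
  qed
  with \<pi>(1) \<rho>(1) show ?thesis
    unfolding hadamard_equivalent_def
    using hadamard_residue_matrix[OF p q N] hadamard_standard[OF N]
    by (intro conjI exI[of _ \<pi>] exI[of _ \<rho>] exI[of _ "\<lambda>_. 1"]) simp_all
qed

section \<open>Recognising a spectrum by Fourier inversion\<close>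

lemma l2_inner_finite:
  "finite B \<Longrightarrow> l2_inner B f g = (\<Sum>x\<in>B. f x * cnj (g x))"
  by (simp add: l2_inner_def lebesgue_integral_count_space_finite)

text \<open>\<open>dual\<close> is orthogonality in the other direction, between the points of
  \<open>B\<close>. It makes Fourier inversion hold, so spanning comes from explicit coefficients
  and not from a dimension count.\<close>

lemma is_spectrumI:
  assumes fin: "finite B" "finite \<Lambda>" and card: "card B = N" and N: "N > 0"
    and ortho: "\<And>s t. s \<in> \<Lambda> \<Longrightarrow> t \<in> \<Lambda> \<Longrightarrow> s \<noteq> t \<Longrightarrow> (\<Sum>x\<in>B. unit_exp ((s - t) * x)) = 0"
    and dual: "\<And>x y. x \<in> B \<Longrightarrow> y \<in> B \<Longrightarrow>
      (\<Sum>t\<in>\<Lambda>. unit_exp (t * (x - y))) = (if x = y then of_nat N else 0)"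
  shows "is_spectrum B \<Lambda>"
proof -
  have inner: "l2_inner B (exponential s) (exponential t) = (\<Sum>x\<in>B. unit_exp ((s - t) * x))" for s t
    unfolding l2_inner_finite[OF fin(1)]
    by (simp add: exponential_eq_unit_exp cnj_unit_exp left_diff_distrib flip: unit_exp_add)
  \<comment> \<open>The coefficients are the inner products of \<open>f\<close> with the
    exponentials, divided by N. After the two sums are exchanged, \<open>dual\<close> leaves only
    the term y = x.\<close>
  have expand: "f x = (\<Sum>t\<in>\<Lambda>. ((\<Sum>y\<in>B. f y * unit_exp (- (t * y))) / of_nat N) * exponential t x)"
    if x: "x \<in> B" for f :: "real \<Rightarrow> complex" and x
  proof -
    have "(\<Sum>t\<in>\<Lambda>. ((\<Sum>y\<in>B. f y * unit_exp (- (t * y))) / of_nat N) * exponential t x)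
        = (\<Sum>t\<in>\<Lambda>. \<Sum>y\<in>B. f y / of_nat N * unit_exp (t * (x - y)))"
      by (intro sum.cong refl)
        (simp add: exponential_eq_unit_exp sum_divide_distrib sum_distrib_left
          right_diff_distrib unit_exp_add[of _ "- _", simplified] mult_ac)
    also have "\<dots> = (\<Sum>y\<in>B. f y / of_nat N * (\<Sum>t\<in>\<Lambda>. unit_exp (t * (x - y))))"
      by (subst sum.swap) (simp add: sum_distrib_left)
    also have "\<dots> = (\<Sum>y\<in>B. if x = y then f y else 0)"
      using N x by (intro sum.cong refl) (simp add: dual)
    also have "\<dots> = f x"
      using fin(1) x by simp
    finally show ?thesis by simp
  qed
  show ?thesis
    unfolding is_spectrum_def orthogonal_basis_on_def
  proof (intro conjI ballI allI impI)
    show "finite B" by fact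
  next
    fix f :: "real \<Rightarrow> complex"
    show "\<exists>J c. finite J \<and> J \<subseteq> \<Lambda> \<and> (\<forall>x\<in>B. f x = (\<Sum>i\<in>J. c i * exponential i x))"
      using fin(2) expand[of _ f]
      by (intro exI[of _ \<Lambda>] exI[of _ "\<lambda>t. (\<Sum>y\<in>B. f y * unit_exp (- (t * y))) / of_nat N"]) blast
  \<comment> \<open>An exponential has squared norm \<open>card B = N\<close>, which is
    nonzero.\<close>
  qed (use card N ortho in \<open>simp_all add: inner\<close>)
qed

section \<open>From the residue form to the spectrum and the equivalence\<close>

text \<open>For \<open>N = 1\<close> the set is a singleton, so even the degenerate dilation
  \<open>c = 0\<close>, which occurs for \<open>B = {0}\<close>, is injective.\<close>

lemma inj_on_mult_if_complete_residues:
  fixes c :: "'a::{idom, ring_char_0}"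
  assumes "complete_residues N A" "N \<noteq> 1 \<Longrightarrow> c \<noteq> 0"
  shows "inj_on (\<lambda>a. c * of_int a) A"
proof (cases "N = 1")
  case True
  then obtain a where "A = {a}"
    using assms(1) by (auto simp: complete_residues_def card_1_singleton_iff)
  then show ?thesis by simp
next
  case False
  with assms(2) show ?thesis by (auto simp: inj_on_def)
qed

text \<open>The phase of a pair is \<open>m * b * l / N\<close>, where
  \<open>m = d * f div S\<close> is a unit modulo N. Hence the inner products are character sums
  over complete residue systems, and every associated matrix is a residue matrix with row labels
  \<open>m * b\<close>.\<close>

lemma spectrum_and_equivalence_if_residue_form:
  fixes B B\<^sub>0 L\<^sub>0 :: "int set" and \<Lambda> :: "real set"
  assumes B: "B = (\<lambda>b. d * b) ` B\<^sub>0" "complete_residues N B\<^sub>0"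
    and form: "spectrum_form N d \<Lambda> f R S L\<^sub>0"
  shows "is_spectrum (real_of_int ` B) \<Lambda>"
    and "\<exists>H. associated_matrix N (real_of_int ` B) \<Lambda> H"
    and "associated_matrix N (real_of_int ` B) \<Lambda> H \<Longrightarrow>
      hadamard_equivalent N H (standard_hadamard_matrix N)"
proof -
  define m where "m = d * f div S"
  define \<beta> where "\<beta> b = real_of_int d * of_int b" for b
  define \<nu> where "\<nu> l = real_of_int f / of_int R * of_int l" for l
  have L: "complete_residues N L\<^sub>0" and R: "R = int N * S" "R \<noteq> 0" and S: "S dvd d * f"
    and cop: "coprime m (int N)" and \<Lambda>: "\<Lambda> = \<nu> ` L\<^sub>0"
    using form by (auto simp: spectrum_form_def m_def \<nu>_def image_def)
  have N: "N > 0" and S0: "S \<noteq> 0" using R by auto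
  have m: "m * S = d * f" using S by (simp add: m_def)
  have B': "real_of_int ` B = \<beta> ` B\<^sub>0" by (auto simp: B(1) \<beta>_def image_image)
  \<comment> \<open>For \<open>N = 1\<close> every integer is coprime to N, so \<open>m\<close> may
    then vanish.\<close>
  have nz: "m \<noteq> 0" if "N \<noteq> 1" using cop that by auto
  then have nz': "d \<noteq> 0" "f \<noteq> 0" if "N \<noteq> 1" using m S0 that by auto
  have inj: "inj_on \<beta> B\<^sub>0" "inj_on \<nu> L\<^sub>0"
    unfolding \<beta>_def \<nu>_def using nz' R(2)
    by (intro inj_on_mult_if_complete_residues[OF B(2)] inj_on_mult_if_complete_residues[OF L]; simp)+
  have bij: "bij_betw \<beta> B\<^sub>0 (real_of_int ` B)" "bij_betw \<nu> L\<^sub>0 \<Lambda>"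
    using inj by (simp_all add: bij_betw_def B' \<Lambda>)
  \<comment> \<open>Here df / R = mS / (NS) = m / N.\<close>
  have prod: "\<nu> l * \<beta> b = of_int (m * b * l) / of_nat N" for l b
  proof -
    have "real_of_int d * of_int f = of_int m * of_int S"
      using m by (metis of_int_mult)
    then have "\<nu> l * \<beta> b = of_int m * of_int S * of_int b * of_int l / of_int R"
      by (simp add: \<nu>_def \<beta>_def mult.assoc mult.commute mult.left_commute)
    then show ?thesis using R S0 N by simp
  qed
  have fin: "finite (real_of_int ` B)" "finite \<Lambda>" "finite B\<^sub>0" "finite L\<^sub>0" "card B\<^sub>0 = N" "card L\<^sub>0 = N"
    using B L \<Lambda> by (auto simp: complete_residues_def)
  have card: "card (real_of_int ` B) = N" "card \<Lambda> = N"
    using bij fin by (metis bij_betw_same_card)+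
  have incong: "\<not> int N dvd m * (a - b)"
    if "complete_residues N C" "a \<in> C" "b \<in> C" "a \<noteq> b" for C a b
    using that cop by (auto simp: complete_residues_def cong_iff_dvd_diff coprime_commute
        coprime_dvd_mult_right_iff)
  show "is_spectrum (real_of_int ` B) \<Lambda>"
  proof (rule is_spectrumI[OF fin(1,2) card(1) N])
    fix s t assume "s \<in> \<Lambda>" "t \<in> \<Lambda>" "s \<noteq> t"
    then obtain k l where kl: "s = \<nu> k" "t = \<nu> l" "k \<in> L\<^sub>0" "l \<in> L\<^sub>0" "k \<noteq> l"
      using \<Lambda> by auto
    have "(\<Sum>x\<in>real_of_int ` B. unit_exp ((s - t) * x)) = (\<Sum>b\<in>B\<^sub>0. unit_exp ((s - t) * \<beta> b))"
      using sum.reindex_bij_betw[OF bij(1), of "\<lambda>x. unit_exp ((s - t) * x)"] by simp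
    also have "\<dots> = (\<Sum>b\<in>B\<^sub>0. unit_exp (of_int (m * (k - l) * b) / of_nat N))"
      by (simp add: kl left_diff_distrib prod) (simp add: algebra_simps diff_divide_distrib)
    also have "\<dots> = 0"
      using incong[OF L kl(3-5)] by (simp only: sum_unit_exp_complete_residues[OF B(2) N] if_False)
    finally show "(\<Sum>x\<in>real_of_int ` B. unit_exp ((s - t) * x)) = 0" .
  next
    fix x y assume "x \<in> real_of_int ` B" "y \<in> real_of_int ` B"
    then obtain a b where ab: "x = \<beta> a" "y = \<beta> b" "a \<in> B\<^sub>0" "b \<in> B\<^sub>0"
      using B' by auto
    have "(\<Sum>t\<in>\<Lambda>. unit_exp (t * (x - y))) = (\<Sum>l\<in>L\<^sub>0. unit_exp (\<nu> l * (x - y)))"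
      using sum.reindex_bij_betw[OF bij(2), of "\<lambda>t. unit_exp (t * (x - y))"] by simp
    also have "\<dots> = (\<Sum>l\<in>L\<^sub>0. unit_exp (of_int (m * (a - b) * l) / of_nat N))"
      by (simp add: ab right_diff_distrib prod) (simp add: algebra_simps diff_divide_distrib)
    also have "\<dots> = (if int N dvd m * (a - b) then of_nat N else 0)"
      by (rule sum_unit_exp_complete_residues[OF L N])
    also have "\<dots> = (if x = y then of_nat N else 0)"
      using incong[OF B(2) ab(3,4)] ab inj(1) by (auto simp: inj_on_def)
    finally show "(\<Sum>t\<in>\<Lambda>. unit_exp (t * (x - y))) = (if x = y then of_nat N else 0)" .
  qed
  show "\<exists>H. associated_matrix N (real_of_int ` B) \<Lambda> H"
  proof -
    obtain b l where "bij_betw b {..<N} (real_of_int ` B)" "bij_betw l {..<N} \<Lambda>"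
      using ex_bij_betw_nat_finite[OF fin(1)] ex_bij_betw_nat_finite[OF fin(2)] card
      by (auto simp: atLeast0LessThan)
    then show ?thesis unfolding associated_matrix_def by blast
  qed
  assume "associated_matrix N (real_of_int ` B) \<Lambda> H"
  then obtain b l where bl: "bij_betw b {..<N} (real_of_int ` B)" "bij_betw l {..<N} \<Lambda>"
    and H: "H = mat N N (\<lambda>(i, j). 1 / of_real (sqrt (real N)) * exponential (l j) (b i))"
    unfolding associated_matrix_def by blast
  \<comment> \<open>The given orderings of \<open>B\<close> and \<Lambda> are pulled back to
    orderings of \<open>B\<^sub>0\<close> and \<open>L\<^sub>0\<close>.\<close>
  define p where "p i = inv_into B\<^sub>0 \<beta> (b i)" for i
  define q where "q j = inv_into L\<^sub>0 \<nu> (l j)" for j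
  have p: "bij_betw p {..<N} B\<^sub>0" and q: "bij_betw q {..<N} L\<^sub>0"
    using bij_betw_trans[OF bl(1) bij_betw_inv_into[OF bij(1)]]
      bij_betw_trans[OF bl(2) bij_betw_inv_into[OF bij(2)]]
    by (simp_all add: p_def[abs_def] q_def[abs_def] o_def)
  have pq: "b i = \<beta> (p i)" "l i = \<nu> (q i)" if "i < N" for i
  proof -
    have "b i \<in> \<beta> ` B\<^sub>0" "l i \<in> \<nu> ` L\<^sub>0"
      using that bl unfolding B' \<Lambda> by (auto simp: bij_betw_def)
    then show "b i = \<beta> (p i)" "l i = \<nu> (q i)"
      by (simp_all add: p_def q_def f_inv_into_f)
  qed
  \<comment> \<open>The unit \<open>m\<close> is put on the row labels, which again form a complete
    residue system.\<close>
  have "H = residue_matrix N (\<lambda>i. m * p i) q"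
    by (rule eq_matI) (simp_all add: H residue_matrix_def exponential_eq_unit_exp pq prod)
  moreover have "bij_betw (\<lambda>i. m * p i) {..<N} ((\<lambda>a. m * a) ` B\<^sub>0)"
    using bij_betw_trans[OF p inj_on_imp_bij_betw[OF complete_residues_mult(2)[OF B(2) cop N]]]
    by (simp add: o_def)
  ultimately show "hadamard_equivalent N H (standard_hadamard_matrix N)"
    using residue_matrix_equivalent_standard q L N complete_residues_mult(1)[OF B(2) cop N]
    by simp
qed

section \<open>Greatest common divisors and primitive parts of integer sets\<close>

text \<open>By Bezout the gcd of a finite set is an integer combination of its elements. The
  induction adds one element at a time, starting from \<open>Gcd {} = 0\<close>.\<close>

lemma real_mult_Gcd_in_Ints:
  fixes X :: "int set" and t :: real
  assumes "finite X" "\<And>x. x \<in> X \<Longrightarrow> t * of_int x \<in> \<int>"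
  shows "t * of_int (Gcd X) \<in> \<int>"
  using assms
proof (induction X)
  case (insert x X)
  obtain u v where "u * x + v * Gcd X = gcd x (Gcd X)"
    using bezout_int by blast
  then have "t * of_int (Gcd (insert x X)) = of_int u * (t * of_int x) + of_int v * (t * of_int (Gcd X))"
    by (simp add: distrib_left flip: of_int_add of_int_mult)
       (metis (no_types, opaque_lifting) distrib_left mult.left_commute of_int_add of_int_mult)
  with insert show ?case by simp
qed simp

text \<open>Divide by g = \<open>Gcd X\<close>, which is positive because some element is nonzero.
  The gcd h of the quotients satisfies g = g h, so h = 1.\<close>

lemma primitive_part:
  fixes X :: "int set"
  assumes "\<not> X \<subseteq> {0}"
  obtains X\<^sub>0 where "X = (\<lambda>x. Gcd X * x) ` X\<^sub>0" "Gcd X\<^sub>0 = 1" "Gcd X > 0"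
proof -
  let ?g = "Gcd X"
  have g: "?g > 0"
    using assms Gcd_0_iff[of X] Gcd_int_greater_eq_0[of X] by linarith
  have X: "X = (\<lambda>x. ?g * x) ` (\<lambda>x. x div ?g) ` X"
    by (force simp: image_image Gcd_dvd)
  define h where "h = Gcd ((\<lambda>x. x div ?g) ` X)"
  have "?g = \<bar>?g * h\<bar>"
    by (subst (1) X) (simp only: h_def Gcd_mult normalize_int_def)
  moreover have "h \<ge> 0" unfolding h_def by (rule Gcd_int_greater_eq_0)
  ultimately have "?g * h = ?g * 1" using g by (simp add: abs_mult)
  then have "Gcd ((\<lambda>x. x div ?g) ` X) = 1" using g unfolding h_def by (metis mult_cancel_left less_irrefl)
  with X g that show thesis by blast
qed

section \<open>Removing the unimodular factors of an equivalence\<close>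

text \<open>\<open>r\<close> and \<open>s\<close> are row and column numbers in the standard matrix,
  counted from the row of 0 in \<open>B\<close> and the column of 0 in \<Lambda>. Distinct indices
  below N stay incongruent after the shift, and every residue occurs, in particular 1.\<close>

lemma dephased_exponents:
  fixes B :: "int set" and \<Lambda> :: "real set"
  assumes assoc: "associated_matrix N (real_of_int ` B) \<Lambda> H"
    and equiv: "hadamard_equivalent N H (standard_hadamard_matrix N)"
    and zero: "0 \<in> B" "0 \<in> \<Lambda>"
  obtains r :: "int \<Rightarrow> int" and s :: "real \<Rightarrow> int"
  where "\<And>b t. b \<in> B \<Longrightarrow> t \<in> \<Lambda> \<Longrightarrow> unit_exp (t * of_int b) = unit_exp (of_int (r b * s t) / of_nat N)"
    and "\<And>a b. a \<in> B \<Longrightarrow> b \<in> B \<Longrightarrow> [r a = r b] (mod int N) \<Longrightarrow> a = b"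
    and "\<And>t u. t \<in> \<Lambda> \<Longrightarrow> u \<in> \<Lambda> \<Longrightarrow> [s t = s u] (mod int N) \<Longrightarrow> t = u"
    and "\<exists>b\<in>B. [r b = 1] (mod int N)"
    and "\<exists>t\<in>\<Lambda>. [s t = 1] (mod int N)"
proof -
  obtain b l where bl: "bij_betw b {..<N} (real_of_int ` B)" "bij_betw l {..<N} \<Lambda>"
    and H: "H = mat N N (\<lambda>(i, j). 1 / of_real (sqrt (real N)) * exponential (l j) (b i))"
    using assoc unfolding associated_matrix_def by blast
  have N: "N > 0" using bl(2) zero(2) by (auto simp: bij_betw_def)
  obtain \<pi> \<rho> c d where perm: "\<pi> permutes {..<N}" "\<rho> permutes {..<N}"
    and ent: "\<And>i j. i < N \<Longrightarrow> j < N \<Longrightarrow>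
      standard_hadamard_matrix N $$ (i, j) = c i * d j * H $$ (\<pi> i, \<rho> j)"
    using equiv unfolding hadamard_equivalent_def by blast
  \<comment> \<open>The orderings are composed with the permutations of the equivalence, so that row
    i of the standard matrix belongs to \<open>x i\<close> and column j to
    \<open>y j\<close>.\<close>
  define x where "x i = b (\<pi> i)" for i
  define y where "y j = l (\<rho> j)" for j
  have bx: "bij_betw x {..<N} (real_of_int ` B)" and yb: "bij_betw y {..<N} \<Lambda>"
    using bij_betw_trans[OF permutes_imp_bij[OF perm(1)] bl(1)]
      bij_betw_trans[OF permutes_imp_bij[OF perm(2)] bl(2)]
    by (simp_all add: x_def[abs_def] y_def[abs_def] o_def)
  define w where "w a = unit_exp (of_int a / of_nat N)" for a
  have w_add: "w (a + b) = w a * w b" for a b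
    by (simp add: w_def add_divide_distrib unit_exp_add)
  have phase: "w (int i * int j) = c i * d j * unit_exp (y j * x i)" if "i < N" "j < N" for i j
  proof -
    have "\<pi> i < N" "\<rho> j < N"
      using perm that by (metis lessThan_iff permutes_in_image)+
    then show ?thesis
      using ent[OF that] that N
      unfolding standard_hadamard_matrix_eq residue_matrix_def H
      by (simp add: exponential_eq_unit_exp x_def y_def w_def)
  qed
  have "0 \<in> x ` {..<N}" "0 \<in> y ` {..<N}"
    using bx yb zero by (auto simp: bij_betw_def image_iff)
  then obtain i0 j0 where i0: "i0 < N" "x i0 = 0" and j0: "j0 < N" "y j0 = 0"
    by fastforce
  have key: "unit_exp (y j * x i) = w ((int i - int i0) * (int j - int j0))" if "i < N" "j < N" for i j
  proof -
    \<comment> \<open>This rests on (i - i0)(j - j0) + i0 j + i j0 = i j + i0 j0.\<close>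
    have split: "w ((int i - int i0) * (int j - int j0)) * (w (int i0 * int j) * w (int i * int j0))
        = w (int i * int j) * w (int i0 * int j0)"
      by (simp flip: w_add) (simp add: algebra_simps)
    have nz: "w a \<noteq> 0" for a by (simp add: w_def)
    \<comment> \<open>The relation \<open>phase\<close> is used at the four corners (i, j), (i0, j),
      (i, j0), (i0, j0). The factors \<open>c\<close> and \<open>d\<close> cancel, and the
      exponential is 1 at the last three corners because \<open>x i0 = 0\<close> or
      \<open>y j0 = 0\<close>.\<close>
    have "unit_exp (y j * x i) * (w (int i0 * int j) * w (int i * int j0))
        = w (int i * int j) * w (int i0 * int j0)"
      using phase[OF that] phase[OF i0(1) that(2)] phase[OF that(1) j0(1)] phase[OF i0(1) j0(1)] i0 j0
      by simp
    with split nz show ?thesis by (metis mult_cancel_right no_zero_divisors)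
  qed
  define ix where "ix a = inv_into {..<N} x (real_of_int a)" for a
  define jy where "jy t = inv_into {..<N} y t" for t
  have ix: "ix a < N" "x (ix a) = real_of_int a" if "a \<in> B" for a
    using bx that inv_into_into[of "real_of_int a" x "{..<N}"] f_inv_into_f[of "real_of_int a" x "{..<N}"]
    by (auto simp: ix_def bij_betw_def)
  have jy: "jy t < N" "y (jy t) = t" if "t \<in> \<Lambda>" for t
    using yb that inv_into_into[of t y "{..<N}"] f_inv_into_f[of t y "{..<N}"]
    by (auto simp: jy_def bij_betw_def)
  have x_inv: "\<exists>a\<in>B. ix a = i" if "i < N" for i
  proof -
    have "x i \<in> real_of_int ` B" using bx that by (auto simp: bij_betw_def)
    then obtain a where "a \<in> B" "x i = real_of_int a" by blast
    moreover from this have "ix a = i"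
      using bx that by (metis bij_betw_def ix_def inv_into_f_f lessThan_iff)
    ultimately show ?thesis by blast
  qed
  have y_inv: "\<exists>t\<in>\<Lambda>. jy t = i" if "i < N" for i
    using yb that by (intro bexI[of _ "y i"]) (auto simp: jy_def bij_betw_def)
  \<comment> \<open>Reduction modulo N handles the wrap-around at \<open>k0 = N - 1\<close>,
    including the case \<open>N = 1\<close>.\<close>
  have succ: "\<exists>k<N. [int k - int k0 = 1] (mod int N)" for k0
    using N by (intro exI[of _ "(k0 + 1) mod N"])
      (auto simp: cong_def zmod_int mod_simps)
  have unshift: "i = i'" if "[int i - c = int i' - c] (mod int N)" "i < N" "i' < N" for i i' c
    using cong_add[OF that(1) cong_refl[of c]] that(2,3) by (simp add: cong_def)
  show thesis
  proof (rule that[of "\<lambda>a. int (ix a) - int i0" "\<lambda>t. int (jy t) - int j0"])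
    fix a t assume "a \<in> B" "t \<in> \<Lambda>"
    then show "unit_exp (t * of_int a)
        = unit_exp (of_int ((int (ix a) - int i0) * (int (jy t) - int j0)) / of_nat N)"
      using key[of "ix a" "jy t"] ix jy by (simp add: w_def)
  next
    fix a a' assume "a \<in> B" "a' \<in> B" "[int (ix a) - int i0 = int (ix a') - int i0] (mod int N)"
    moreover from this have "ix a = ix a'"
      using ix(1) by (auto intro: unshift)
    ultimately show "a = a'" using ix(2) by (metis of_int_eq_iff)
  next
    fix t t' assume "t \<in> \<Lambda>" "t' \<in> \<Lambda>" "[int (jy t) - int j0 = int (jy t') - int j0] (mod int N)"
    moreover from this have "jy t = jy t'"
      using jy(1) by (auto intro: unshift)
    ultimately show "t = t'" using jy(2) by metis
  next
    show "\<exists>a\<in>B. [int (ix a) - int i0 = 1] (mod int N)" using succ[of i0] x_inv by metis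
    show "\<exists>t\<in>\<Lambda>. [int (jy t) - int j0 = 1] (mod int N)" using succ[of j0] y_inv by metis
  qed
qed

text \<open>The arguments of equal phases differ by an integer z; multiplication by N gives
  \<open>n = k + int N * z\<close>.\<close>

lemma unit_exp_eq_residueE:
  assumes "unit_exp t = unit_exp (of_int k / of_nat N)" "N > 0"
  obtains n where "t * of_nat N = of_int n" "[n = k] (mod int N)"
proof -
  obtain z where "t - of_int k / of_nat N = of_int z"
    using assms(1) by (auto simp: unit_exp_eq_iff elim: Ints_cases)
  then have "t * of_nat N = of_int (k + int N * z)"
    using assms(2) by (simp add: field_simps)
  moreover have "[k + int N * z = k] (mod int N)" by (simp add: cong_def)
  ultimately show thesis by (rule that)
qed

section \<open>From the equivalence to the residue form\<close>

text \<open>Take d = \<open>Gcd B\<close> and fix t in \<Lambda> with \<open>s t\<close> congruent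
  to 1. Then N t b is an integer congruent to \<open>r b\<close> for each b in \<open>B\<close>, and
  by Bezout N t d is an integer m. So \<open>r (d * b)\<close> is congruent to \<open>m * b\<close>:
  the residue of an element of \<open>B\<^sub>0\<close> determines the value of \<open>r\<close>
  modulo N, hence the element.\<close>

lemma residue_form_of_domain:
  fixes B :: "int set" and \<Lambda> :: "real set"
  assumes "finite B" "card B = N" "0 \<in> B" "0 \<in> \<Lambda>"
    and "associated_matrix N (real_of_int ` B) \<Lambda> H"
    and "hadamard_equivalent N H (standard_hadamard_matrix N)"
  shows "\<exists>d B\<^sub>0. B = (\<lambda>b. d * b) ` B\<^sub>0 \<and> complete_residues N B\<^sub>0 \<and> Gcd B\<^sub>0 = 1"
proof (cases "B \<subseteq> {0}")
  case True
  then have "B = {0}" using assms(3) by auto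
  with assms(2) have "N = 1" by simp
  with \<open>B = {0}\<close> show ?thesis
    \<comment> \<open>The gcd of \<open>{0}\<close> is 0, so \<open>B = {0}\<close> is written as 0
      times the primitive set \<open>{1}\<close>.\<close>
    by (intro exI[of _ 0] exI[of _ "{1}"]) (auto simp: complete_residues_def)
next
  case False
  obtain B\<^sub>0 where B: "B = (\<lambda>b. Gcd B * b) ` B\<^sub>0" and B\<^sub>0: "Gcd B\<^sub>0 = 1" and g: "Gcd B > 0"
    using primitive_part[OF False] .
  have N: "N > 0" using assms(1-3) card_gt_0_iff by blast
  obtain r s where exps: "\<And>b t. b \<in> B \<Longrightarrow> t \<in> \<Lambda> \<Longrightarrow>
      unit_exp (t * of_int b) = unit_exp (of_int (r b * s t) / of_nat N)"
    and r: "\<And>a b. a \<in> B \<Longrightarrow> b \<in> B \<Longrightarrow> [r a = r b] (mod int N) \<Longrightarrow> a = b"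
    and ex: "\<exists>t\<in>\<Lambda>. [s t = 1] (mod int N)"
    using dephased_exponents[OF assms(5,6,3,4)] by metis
  from ex obtain t where t: "t \<in> \<Lambda>" "[s t = 1] (mod int N)" by blast
  have n: "\<exists>n. t * of_nat N * of_int b = of_int n \<and> [n = r b] (mod int N)" if b: "b \<in> B" for b
  proof -
    obtain n where "t * of_int b * of_nat N = of_int n" "[n = r b * s t] (mod int N)"
      using unit_exp_eq_residueE[OF exps[OF b t(1)] N] .
    moreover have "[r b * s t = r b] (mod int N)"
      using cong_mult[OF cong_refl t(2), of "r b"] by simp
    ultimately show ?thesis by (metis cong_trans mult.assoc mult.commute)
  qed
  have "t * of_nat N * of_int (Gcd B) \<in> \<int>"
    using assms(1) by (intro real_mult_Gcd_in_Ints) (auto dest!: n)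
  then obtain m where m: "t * of_nat N * of_int (Gcd B) = of_int m"
    by (auto elim: Ints_cases)
  have mr: "[m * b = r (Gcd B * b)] (mod int N)" if b: "b \<in> B\<^sub>0" for b
  proof -
    have "Gcd B * b \<in> B" by (subst (2) B) (use b in blast)
    then obtain n' where n': "t * of_nat N * of_int (Gcd B * b) = of_int n'"
      "[n' = r (Gcd B * b)] (mod int N)" using n by blast
    then have "of_int n' = real_of_int (m * b)" using m by (simp flip: m)
    then have "n' = m * b" by (simp only: of_int_eq_iff)
    with n'(2) show ?thesis by simp
  qed
  have "a = b" if "a \<in> B\<^sub>0" "b \<in> B\<^sub>0" "[a = b] (mod int N)" for a b
  proof -
    have "[r (Gcd B * a) = r (Gcd B * b)] (mod int N)"
      using mr[OF that(1)] mr[OF that(2)] cong_scalar_left[OF that(3), of m]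
      by (metis cong_sym cong_trans)
    moreover have "Gcd B * a \<in> B" "Gcd B * b \<in> B" by (subst (2) B; use that in blast)+
    ultimately have "Gcd B * a = Gcd B * b" by (intro r)
    with g show ?thesis by (metis mult_cancel_left less_irrefl)
  qed
  moreover have inj: "inj_on (\<lambda>b. Gcd B * b) B\<^sub>0" using g unfolding inj_on_def by (metis mult_cancel_left less_irrefl)
  moreover have "finite B\<^sub>0" using assms(1) B inj by (metis finite_imageD)
  moreover have "card B\<^sub>0 = N" using assms(2) B inj by (metis card_image)
  ultimately have "complete_residues N B\<^sub>0" by (auto simp: complete_residues_def)
  with B B\<^sub>0 show ?thesis by blast
qed

text \<open>The witnesses are \<open>R = int N * d\<close>, \<open>S = d\<close> and, for f, the gcd
  of the integers N d t with t in \<Lambda>. Then df / S is f itself, and it remains to see that f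
  is coprime to N and that \<open>L\<^sub>0\<close> is incongruent. The case \<open>N = 1\<close> is
  separate because it forces \<open>d = 0\<close>.\<close>

lemma residue_form_of_spectrum:
  fixes B :: "int set" and \<Lambda> :: "real set"
  assumes "finite B" "card B = N" "0 \<in> B" "0 \<in> \<Lambda>"
    and "associated_matrix N (real_of_int ` B) \<Lambda> H"
    and "hadamard_equivalent N H (standard_hadamard_matrix N)"
    and B: "B = (\<lambda>b. d * b) ` B\<^sub>0" and res: "complete_residues N B\<^sub>0" and gcd: "Gcd B\<^sub>0 = 1"
  shows "\<exists>f R S L\<^sub>0. spectrum_form N d \<Lambda> f R S L\<^sub>0"
proof -
  have "\<exists>l. bij_betw l {..<N} \<Lambda>" using assms(5) by (auto simp: associated_matrix_def)
  then have fin\<Lambda>: "finite \<Lambda>" and card\<Lambda>: "card \<Lambda> = N"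
    using bij_betw_finite bij_betw_same_card by fastforce+
  have N: "N > 0" using assms(1-3) card_gt_0_iff by blast
  show ?thesis
  proof (cases "N = 1")
    case True
    then have "\<Lambda> = {0}" using card\<Lambda> assms(4) by (auto simp: card_1_singleton_iff)
    \<comment> \<open>\<open>B\<^sub>0 = {b}\<close> with gcd 1 makes b equal to 1 or -1, while
      \<open>d * b = 0\<close>.\<close>
    moreover have "d = 0"
    proof -
      have "B = {0}" using True assms(2,3) by (auto simp: card_1_singleton_iff)
      moreover obtain b where "B\<^sub>0 = {b}" using True res
        by (auto simp: complete_residues_def card_1_singleton_iff)
      ultimately show ?thesis using B gcd by auto
    qed
    ultimately show ?thesis using True
      \<comment> \<open>With \<open>d = 0\<close> the choice \<open>S = d\<close> would make R
        vanish. Instead f = 0 and S = 1 are admissible, since 0 is coprime to 1.\<close>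
      by (intro exI[of _ 0] exI[of _ 1] exI[of _ 1] exI[of _ "{1}"])
        (simp add: spectrum_form_def complete_residues_def)
  next
    case False
    have d: "d \<noteq> 0"
    proof
      assume "d = 0"
      then have "B \<subseteq> {0}" using B by auto
      then have "card B \<le> 1" using card_mono[of "{0}" B] by simp
      with False N assms(2) show False by simp
    qed
    obtain r s where exps: "\<And>b t. b \<in> B \<Longrightarrow> t \<in> \<Lambda> \<Longrightarrow>
        unit_exp (t * of_int b) = unit_exp (of_int (r b * s t) / of_nat N)"
      and s: "\<And>t u. t \<in> \<Lambda> \<Longrightarrow> u \<in> \<Lambda> \<Longrightarrow> [s t = s u] (mod int N) \<Longrightarrow> t = u"
      and exr: "\<exists>b\<in>B. [r b = 1] (mod int N)" and exs: "\<exists>t\<in>\<Lambda>. [s t = 1] (mod int N)"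
      using dephased_exponents[OF assms(5,6,3,4)] by metis
    \<comment> \<open>Each \<open>d * b\<close> lies in \<open>B\<close>, so t N d b is an integer
      for all b in \<open>B\<^sub>0\<close>; Bezout and \<open>Gcd B\<^sub>0 = 1\<close> then remove
      b.\<close>
    have mult: "t * of_nat N * of_int d \<in> \<int>" if t: "t \<in> \<Lambda>" for t
    proof -
      have "t * of_nat N * of_int d * of_int (Gcd B\<^sub>0) \<in> \<int>"
      proof (rule real_mult_Gcd_in_Ints)
        show "finite B\<^sub>0" using res by (simp add: complete_residues_def)
        fix b assume "b \<in> B\<^sub>0"
        then have "d * b \<in> B" using B by blast
        from unit_exp_eq_residueE[OF exps[OF this t] N] obtain n
          where "t * of_int (d * b) * of_nat N = of_int n" .
        then have "t * of_nat N * of_int d * of_int b = of_int n" by (simp add: mult_ac)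
        then show "t * of_nat N * of_int d * of_int b \<in> \<int>" by simp
      qed
      with gcd show ?thesis by simp
    qed
    \<comment> \<open>The floor gives an integer-valued function; on \<Lambda> it is exact by
      \<open>mult\<close>.\<close>
    define \<mu> where "\<mu> t = \<lfloor>t * of_nat N * of_int d\<rfloor>" for t :: real
    have \<mu>: "real_of_int (\<mu> t) = t * of_nat N * of_int d" if "t \<in> \<Lambda>" for t
      using mult[OF that] by (simp add: \<mu>_def)
    have inj\<mu>: "inj_on \<mu> \<Lambda>"
    proof (rule inj_onI)
      fix t u assume "t \<in> \<Lambda>" "u \<in> \<Lambda>" "\<mu> t = \<mu> u"
      then have "t * of_nat N * of_int d = u * of_nat N * of_int d" using \<mu> by metis
      with N d show "t = u" by simp
    qed
    have "\<not> \<mu> ` \<Lambda> \<subseteq> {0}"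
    proof
      assume "\<mu> ` \<Lambda> \<subseteq> {0}"
      then have "card (\<mu> ` \<Lambda>) \<le> 1" using card_mono[of "{0}" "\<mu> ` \<Lambda>"] by simp
      with False N card\<Lambda> show False by (simp add: card_image inj\<mu>)
    qed
    then obtain L\<^sub>0 where L: "\<mu> ` \<Lambda> = (\<lambda>x. Gcd (\<mu> ` \<Lambda>) * x) ` L\<^sub>0"
      and gcdL: "Gcd L\<^sub>0 = 1" and gpos: "Gcd (\<mu> ` \<Lambda>) > 0"
      by (rule primitive_part)
    define f where "f = Gcd (\<mu> ` \<Lambda>)"
    have f: "f > 0" and L: "\<mu> ` \<Lambda> = (\<lambda>x. f * x) ` L\<^sub>0" using gpos L by (simp_all add: f_def)
    \<comment> \<open>\<open>\<nu> l\<close> is the solution t of t N d = f l.\<close>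
    define \<nu> where "\<nu> l = 1 / real_of_int (int N * d) * (of_int f * of_int l)" for l
    have \<nu>_eq: "t = \<nu> l" if "t \<in> \<Lambda>" "\<mu> t = f * l" for t l
    proof -
      have "t * of_nat N * of_int d = of_int (f * l)" using \<mu>[OF that(1)] that(2) by simp
      with N d show ?thesis by (simp add: \<nu>_def field_simps)
    qed
    have \<nu>_in: "\<nu> l \<in> \<Lambda>" if "l \<in> L\<^sub>0" for l
    proof -
      have "f * l \<in> \<mu> ` \<Lambda>" using L that by blast
      then show ?thesis using \<nu>_eq by auto
    qed
    have \<Lambda>: "\<Lambda> = \<nu> ` L\<^sub>0"
    proof
      show "\<Lambda> \<subseteq> \<nu> ` L\<^sub>0"
      proof
        fix t assume t: "t \<in> \<Lambda>"
        then have "\<mu> t \<in> (\<lambda>x. f * x) ` L\<^sub>0" using L by blast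
        then show "t \<in> \<nu> ` L\<^sub>0" using \<nu>_eq[OF t] by blast
      qed
    qed (use \<nu>_in in blast)
    have inj\<nu>: "inj_on \<nu> L\<^sub>0" using N d f by (auto simp: inj_on_def \<nu>_def)
    have cong: "[f * l * b = r (d * b) * s (\<nu> l)] (mod int N)" if l: "l \<in> L\<^sub>0" and b: "b \<in> B\<^sub>0" for l b
    proof -
      have "d * b \<in> B" using B b by blast
      from unit_exp_eq_residueE[OF exps[OF this \<nu>_in[OF l]] N] obtain n
        where n: "\<nu> l * of_int (d * b) * of_nat N = of_int n"
          "[n = r (d * b) * s (\<nu> l)] (mod int N)" .
      have "of_int n = real_of_int (f * l * b)" using N d by (simp add: \<nu>_def flip: n(1))
      then have "n = f * l * b" by (simp only: of_int_eq_iff)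
      with n(2) show ?thesis by simp
    qed
    obtain b where b: "b \<in> B\<^sub>0" "[r (d * b) = 1] (mod int N)" using exr B by auto
    obtain l where l: "l \<in> L\<^sub>0" "[s (\<nu> l) = 1] (mod int N)" using exs \<Lambda> by auto
    \<comment> \<open>With b at row residue 1, the residue of \<open>k\<close> determines that of
      \<open>s (\<nu> k)\<close>, and so the point \<open>\<nu> k\<close> of \<Lambda>.\<close>
    have one: "[f * k * b = s (\<nu> k)] (mod int N)" if k: "k \<in> L\<^sub>0" for k
      using cong[OF k b(1)] cong_mult[OF b(2) cong_refl, of "s (\<nu> k)"]
      by (metis cong_trans mult_1)
    \<comment> \<open>Choosing column residue 1 as well exhibits \<open>l * b\<close> as an inverse
      of \<open>f\<close> modulo N.\<close>
    have "[f * (l * b) = 1] (mod int N)"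
      using cong_trans[OF one[OF l(1)] l(2)] by (simp add: mult.assoc)
    then have cop: "coprime f (int N)"
      using coprime_iff_invertible_int by blast
    have "k = k'" if "k \<in> L\<^sub>0" "k' \<in> L\<^sub>0" "[k = k'] (mod int N)" for k k'
    proof -
      have "[f * k * b = f * k' * b] (mod int N)"
        using that(3) by (intro cong_mult cong_refl)
      then have "[s (\<nu> k) = s (\<nu> k')] (mod int N)"
        using one that(1,2) by (metis cong_sym cong_trans)
      then have "\<nu> k = \<nu> k'" using \<nu>_in that by (intro s) auto
      with inj\<nu> that show ?thesis by (auto simp: inj_on_def)
    qed
    moreover have "finite L\<^sub>0" using fin\<Lambda> \<Lambda> inj\<nu> by (metis finite_imageD)
    moreover have "card L\<^sub>0 = N" using card\<Lambda> \<Lambda> inj\<nu> by (metis card_image)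
    ultimately have "complete_residues N L\<^sub>0" by (auto simp: complete_residues_def)
    then have "spectrum_form N d \<Lambda> f (int N * d) d L\<^sub>0"
      using \<Lambda> gcdL N d cop by (simp add: spectrum_form_def \<nu>_def[abs_def])
    then show ?thesis by blast
  qed
qed

text \<open>The form of \<Lambda> is asserted for every primitive representation of
  \<open>B\<close>, not just for the one constructed. In the converse, the existence of an
  associated matrix keeps the claim about all such matrices from being vacuous.\<close>

theorem theorem1p18:
  fixes N :: nat and B :: "int set" and \<Lambda> :: "real set"
  shows
    "(finite B \<and> card B = N \<and> is_spectrum (real_of_int ` B) \<Lambda> \<and> 0 \<in> B \<and> 0 \<in> \<Lambda> \<and>
      (\<exists>H. associated_matrix N (real_of_int ` B) \<Lambda> H \<and>
           hadamard_equivalent N H (standard_hadamard_matrix N))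
      \<longrightarrow>
      (\<exists>d B\<^sub>0. B = (\<lambda>b. d * b) ` B\<^sub>0 \<and> complete_residues N B\<^sub>0 \<and> Gcd B\<^sub>0 = 1) \<and>
      (\<forall>d B\<^sub>0. B = (\<lambda>b. d * b) ` B\<^sub>0 \<and> complete_residues N B\<^sub>0 \<and> Gcd B\<^sub>0 = 1
         \<longrightarrow> (\<exists>f R S L\<^sub>0. spectrum_form N d \<Lambda> f R S L\<^sub>0)))
     \<and>
     (\<forall>d f R S B\<^sub>0 L\<^sub>0.
        B = (\<lambda>b. d * b) ` B\<^sub>0 \<and> complete_residues N B\<^sub>0 \<and> Gcd B\<^sub>0 = 1 \<and>
        spectrum_form N d \<Lambda> f R S L\<^sub>0 \<and> 0 \<in> B \<and> 0 \<in> \<Lambda>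
        \<longrightarrow>
        is_spectrum (real_of_int ` B) \<Lambda> \<and>
        (\<exists>H. associated_matrix N (real_of_int ` B) \<Lambda> H) \<and>
        (\<forall>H. associated_matrix N (real_of_int ` B) \<Lambda> H \<longrightarrow>
             hadamard_equivalent N H (standard_hadamard_matrix N)))"
proof (rule conjI)
  show "finite B \<and> card B = N \<and> is_spectrum (real_of_int ` B) \<Lambda> \<and> 0 \<in> B \<and> 0 \<in> \<Lambda> \<and>
      (\<exists>H. associated_matrix N (real_of_int ` B) \<Lambda> H \<and>
           hadamard_equivalent N H (standard_hadamard_matrix N))
      \<longrightarrow>
      (\<exists>d B\<^sub>0. B = (\<lambda>b. d * b) ` B\<^sub>0 \<and> complete_residues N B\<^sub>0 \<and> Gcd B\<^sub>0 = 1) \<and>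
      (\<forall>d B\<^sub>0. B = (\<lambda>b. d * b) ` B\<^sub>0 \<and> complete_residues N B\<^sub>0 \<and> Gcd B\<^sub>0 = 1
         \<longrightarrow> (\<exists>f R S L\<^sub>0. spectrum_form N d \<Lambda> f R S L\<^sub>0))"
    by (intro impI conjI allI; elim conjE exE)
      (rule residue_form_of_domain residue_form_of_spectrum; assumption)+
qed (use spectrum_and_equivalence_if_residue_form in meson)

end
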